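(* Let $h(x) = c_0 + c_1 x + \cdots + c_n x^n \in \mathbb{R}_n[x]$ be a polynomial with nonnegative coefficients, let $f(x) = \sum_{i=0}^n c_i x^i (1+x)^{n-i}$, and for a positive integer $r$ define $\mathcal{D}_{n,r}(h(x)) \in \mathbb{R}_n[x]$ by \[ f(0) + \sum_{m \ge 1} \left( f(rm) - f(rm-1) \right) x^m = \frac{\mathcal{D}_{n,r}(h(x))}{(1-x)^n}. \] (a) The polynomial $\mathcal{D}_{n,r}(h(x))$ is real-rooted. (b) If $c_0 + c_1 + \cdots + c_i \le c_n + c_{n-1} + \cdots + c_{n-i}$ for all $0 \le i \le \lfloor n/2 \rfloor$, then $\mathcal{D}_{n,r}(h(x))$ has a nonnegative, real-rooted symmetric decomposition with respect to $n$.
   Context: $\mathbb{R}_n[x]$ denotes the space of real polynomials of degree at most $n$. A polynomial is real-rooted if all its roots are real or it is identically zero. Every $p(x)\in\mathbb{R}_m[x]$ can be written uniquely as $p(x)=a(x)+x\,b(x)$ with $a(x)=x^m a(1/x)$ and $b(x)=x^{m-1}b(1/x)$; this is the symmetric decomposition of $p$ with respect to $m$. It is called nonnegative (resp. real-rooted) if both $a(x)$ and $b(x)$ have nonnegative coefficients (resp. are real-rooted). *)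

theory Defs
  imports Complex_Main "HOL-Computational_Algebra.Computational_Algebra"
begin

definition real_rooted :: "real poly \<Rightarrow> bool" where
  "real_rooted p \<longleftrightarrow>
     p = 0 \<or> (\<forall>z::complex. poly (map_poly complex_of_real p) z = 0 \<longrightarrow> z \<in> \<real>)"

definition nonneg_coeffs :: "real poly \<Rightarrow> bool" where
  "nonneg_coeffs p \<longleftrightarrow> (\<forall>i. coeff p i \<ge> 0)"

text \<open>
  The identity \<open>p(x) = x^k p(1/x)\<close>, stated at all nonzero real points. The exponent is an
  integer, so that the case \<open>k = -1\<close> (arising for the second component of a decomposition with
  respect to \<open>0\<close>) has its usual meaning; it then forces \<open>p = 0\<close>.
\<close>

definition self_reciprocal :: "int \<Rightarrow> real poly \<Rightarrow> bool" where
  "self_reciprocal k p \<longleftrightarrow> (\<forall>x. x \<noteq> 0 \<longrightarrow> poly p x = x powi k * poly p (1 / x))"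

definition symmetric_decomposition ::
    "nat \<Rightarrow> real poly \<Rightarrow> real poly \<Rightarrow> real poly \<Rightarrow> bool" where
  "symmetric_decomposition m p a b \<longleftrightarrow>
     p = a + [:0, 1:] * b \<and> self_reciprocal (int m) a \<and> self_reciprocal (int m - 1) b"

lemma poly_eq_off_zeroI:
  fixes p q :: "real poly"
  assumes "\<And>x. x \<noteq> 0 \<Longrightarrow> x \<noteq> 1 \<Longrightarrow> poly p x = poly q x"
  shows "p = q"
proof -
  have "[:0, 1:] * [:-1, 1:] * p = [:0, 1:] * [:-1, 1:] * q"
  proof (rule poly_ext)
    fix x
    show "poly ([:0, 1:] * [:-1, 1:] * p) x = poly ([:0, 1:] * [:-1, 1:] * q) x"
      using assms[of x] by (cases "x = 0 \<or> x = 1") auto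
  qed
  then show ?thesis
    by (simp del: mult_pCons_left mult_pCons_right)
qed

lemma symmetric_decomposition_unique:
  assumes "symmetric_decomposition m p a b" "symmetric_decomposition m p a' b'"
  shows "a = a' \<and> b = b'"
proof -
  have *: "poly p x - x ^ m * poly p (1 / x) = (x - 1) * poly b x"
    if "symmetric_decomposition m p a b" "x \<noteq> 0" for a b x
  proof -
    have p: "p = a + [:0, 1:] * b" and a: "poly a x = x ^ m * poly a (1 / x)"
      and b: "poly b x = x powi (int m - 1) * poly b (1 / x)"
      using that unfolding symmetric_decomposition_def self_reciprocal_def power_int_of_nat
      by blast+
    have "x ^ m * poly p (1 / x) = x ^ m * poly a (1 / x) + x ^ m / x * poly b (1 / x)"
      by (simp add: p algebra_simps)
    also have "x ^ m / x = x powi (int m - 1)"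
      using \<open>x \<noteq> 0\<close> by (simp add: power_int_diff)
    finally show ?thesis
      using a b by (simp add: p algebra_simps)
  qed
  have "b = b'"
  proof (rule poly_eq_off_zeroI)
    fix x :: real
    assume "x \<noteq> 0" "x \<noteq> 1"
    then show "poly b x = poly b' x"
      using *[OF assms(1), of x] *[OF assms(2), of x] by simp
  qed
  then show ?thesis
    using assms by (auto simp: symmetric_decomposition_def)
qed

lemma symmetric_decomposition_exists:
  assumes "degree p \<le> m"
  shows "\<exists>a b. symmetric_decomposition m p a b"
proof -
  define q where "q = (\<Sum>i\<le>m. monom (coeff p i) (m - i))"
  have q: "poly q x = x ^ m * poly p (1 / x)" if "x \<noteq> 0" for x
  proof -
    have "poly p (1 / x) = (\<Sum>i\<le>m. coeff p i * (1 / x) ^ i)"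
      unfolding poly_altdef
      by (rule sum.mono_neutral_left) (use assms in \<open>auto simp: coeff_eq_0\<close>)
    then show ?thesis
      using that
      by (auto simp: q_def poly_sum poly_monom sum_distrib_left power_diff field_simps
          intro!: sum.cong)
  qed
  have qinv: "x ^ m * poly q (1 / x) = poly p x" if "x \<noteq> 0" for x
    using that q[of "1 / x"] by (simp add: power_one_over)
  have "poly (p - q) 1 = 0"
    using q[of 1] by simp
  then obtain b where b: "p - q = [:-1, 1:] * b"
    unfolding poly_eq_0_iff_dvd by auto
  define a where "a = q - b"
  have pq: "poly p x - poly q x = (x - 1) * poly b x" for x
    using arg_cong[OF b, of "\<lambda>p. poly p x"] by (simp add: algebra_simps)
  have pab: "p = a + [:0, 1:] * b"
    by (rule poly_ext) (use pq in \<open>simp add: a_def algebra_simps\<close>)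
  have sb: "poly b x = x powi (int m - 1) * poly b (1 / x)" if "x \<noteq> 0" for x
  proof (cases "x = 1")
    case False
    have "(1 / x - 1) * (x ^ m * poly b (1 / x)) = x ^ m * poly p (1 / x) - x ^ m * poly q (1 / x)"
      unfolding right_diff_distrib[symmetric] pq by (simp add: mult_ac)
    also have "\<dots> = (1 - x) * poly b x"
      using q[OF that] qinv[OF that] pq[of x] by (simp add: algebra_simps)
    also have "\<dots> = (1 / x - 1) * (x * poly b x)"
      using that by (simp add: field_simps)
    finally have "x ^ m * poly b (1 / x) = x * poly b x"
      using False that by (subst (asm) mult_cancel_left) (auto simp: field_simps)
    then show ?thesis
      using that by (simp add: power_int_diff field_simps)
  qed auto
  have sa: "poly a x = x ^ m * poly a (1 / x)" if "x \<noteq> 0" for x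
  proof -
    have "x ^ m * poly b (1 / x) = x * poly b x"
      using sb[OF that] that by (simp add: power_int_diff field_simps)
    then show ?thesis
      using qinv[OF that] pq[of x] by (simp add: a_def algebra_simps)
  qed
  show ?thesis
    using pab sa sb unfolding symmetric_decomposition_def self_reciprocal_def power_int_of_nat by blast
qed

definition h_to_f :: "nat \<Rightarrow> real poly \<Rightarrow> real poly" where
  "h_to_f n h = (\<Sum>i\<le>n. monom (coeff h i) i * [:1, 1:] ^ (n - i))"

definition D_series :: "nat \<Rightarrow> nat \<Rightarrow> real poly \<Rightarrow> real fps" where
  "D_series n r h = Abs_fps (\<lambda>m.
     if m = 0 then poly (h_to_f n h) 0
     else poly (h_to_f n h) (real (r * m)) - poly (h_to_f n h) (real (r * m) - 1))"

definition D_op :: "nat \<Rightarrow> nat \<Rightarrow> real poly \<Rightarrow> real poly" where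
  "D_op n r h =
     (THE D. degree D \<le> n \<and> D_series n r h = fps_of_poly D / (1 - fps_X) ^ n)"

lemma degree_h_to_f: "degree (h_to_f n h) \<le> n"
  unfolding h_to_f_def
proof (rule degree_sum_le, simp)
  fix i assume "i \<in> {..n}"
  have "degree (monom (coeff h i) i * [:1, 1:] ^ (n - i))
      \<le> degree (monom (coeff h i) i) + degree ([:1, 1::real:] ^ (n - i))"
    by (rule degree_mult_le)
  also have "\<dots> \<le> i + (n - i)"
    by (intro add_mono degree_monom_le) (simp add: degree_linear_power)
  finally show "degree (monom (coeff h i) i * [:1, 1:] ^ (n - i)) \<le> n"
    using \<open>i \<in> {..n}\<close> by simp
qed

lemma backward_difference_degree:
  fixes p :: "real poly"
  assumes "degree p \<le> n"
  shows "p - pcompose p [:-1, 1:] = 0 \<or> degree (p - pcompose p [:-1, 1:]) < n"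
proof (cases "degree p = 0")
  case True
  then show ?thesis
    by (auto elim!: degree_eq_zeroE simp: pcompose_pCons)
next
  case False
  define q where "q = pcompose p [:-1, 1:]"
  have dq: "degree q = degree p"
    by (simp add: q_def degree_pcompose)
  have "lead_coeff q = lead_coeff p"
    unfolding q_def by (subst lead_coeff_comp) auto
  then have 0: "coeff (p - q) (degree p) = 0"
    by (simp add: dq)
  have "degree (p - q) \<le> degree p"
    by (rule degree_diff_le) (auto simp: dq)
  moreover have "degree (p - q) \<noteq> degree p \<or> p - q = 0"
    using 0 by (metis leading_coeff_0_iff)
  ultimately show ?thesis
    using assms unfolding q_def by linarith
qed

lemma eventually_poly_series_coeff_0:
  fixes A :: "real fps"
  assumes "\<And>m. m \<ge> N \<Longrightarrow> fps_nth A m = poly g (real m)" "g = 0 \<or> degree g < n" "k \<ge> N + n"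
  shows "fps_nth (A * (1 - fps_X) ^ n) k = 0"
  using assms
proof (induction n arbitrary: A g N)
  case 0
  then show ?case by simp
next
  case (Suc n)
  define g' where "g' = g - pcompose g [:-1, 1:]"
  have "fps_nth (A * (1 - fps_X)) m = poly g' (real m)" if "m \<ge> Suc N" for m
  proof -
    define l where "l = m - 1"
    have l: "m = Suc l" "l \<ge> N"
      using that unfolding l_def by linarith+
    have "fps_nth (A * (1 - fps_X)) m = fps_nth A m - fps_nth A l"
      by (simp add: l(1) right_diff_distrib)
    also have "\<dots> = poly g (real m) - poly g (real l)"
      using Suc.prems(1)[of l] Suc.prems(1)[of m] l by simp
    also have "\<dots> = poly g' (real m)"
      by (simp add: g'_def poly_pcompose l(1))
    finally show ?thesis .
  qed
  moreover have "g' = 0 \<or> degree g' < n"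
    using backward_difference_degree[of g n] Suc.prems(2) by (auto simp: g'_def)
  ultimately have "fps_nth (A * (1 - fps_X) * (1 - fps_X) ^ n) k = 0"
    using Suc.prems(3) by (intro Suc.IH[of "Suc N" _ g']) auto
  then show ?case
    by (simp add: mult.assoc)
qed

lemma D_op_ex1:
  "\<exists>!D. degree D \<le> n \<and> D_series n r h = fps_of_poly D / (1 - fps_X) ^ n"
proof -
  define U :: "real fps" where "U = (1 - fps_X) ^ n"
  have U0: "U \<noteq> 0" and U_unit: "is_unit U"
    by (auto simp: U_def fps_is_unit_iff fps_nth_power_0 dest: arg_cong[of _ _ "\<lambda>f. fps_nth f 0"])
  have div_iff: "A = B / U \<longleftrightarrow> A * U = B" for A B :: "real fps"
    using U0 U_unit by (metis dvd_div_mult_self nonzero_mult_div_cancel_right unit_imp_dvd)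
  define q where "q = h_to_f n h - pcompose (h_to_f n h) [:-1, 1:]"
  define g where "g = pcompose q [:0, real r:]"
  have "q = 0 \<or> degree q < n"
    using backward_difference_degree[OF degree_h_to_f] by (simp add: q_def)
  moreover have "degree g \<le> degree q"
    by (cases "r = 0") (auto simp: g_def degree_pcompose)
  ultimately have g: "g = 0 \<or> degree g < n"
    by (auto simp: g_def)
  have "fps_nth (D_series n r h) m = poly g (real m)" if "m \<ge> 1" for m
    using that by (simp add: D_series_def g_def q_def poly_pcompose algebra_simps)
  then have 0: "fps_nth (D_series n r h * U) k = 0" if "k \<ge> 1 + n" for k
    unfolding U_def using g that by (rule eventually_poly_series_coeff_0)
  define D where "D = (\<Sum>i\<le>n. monom (fps_nth (D_series n r h * U) i) i)"
  have cD: "coeff D k = fps_nth (D_series n r h * U) k" for k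
    using 0[of k] by (auto simp: D_def coeff_sum)
  have "degree D \<le> n"
    by (rule degree_le) (use 0 in \<open>auto simp: cD\<close>)
  moreover have "D_series n r h * U = fps_of_poly D"
    by (rule fps_ext) (simp add: cD)
  ultimately show ?thesis
    unfolding U_def[symmetric] div_iff by (metis fps_of_poly_eq_iff)
qed

end

theory Submission
  imports Defs
begin

text \<open>
  Write \<open>r = s + 1\<close>. The coefficients of \<open>x\<^sup>m\<close> in the series \<open>(1 - x) \<Sum>\<^sub>m m\<^sup>i (m + 1)\<^sup>n\<^sup>-\<^sup>i x\<^sup>m\<close>,
  split by residue classes of \<open>m\<close> modulo \<open>r\<close>, give \<open>r (n + 1)\<close> polynomials over \<open>(1 - x)\<^sup>n\<close>.
  Ordered by decreasing residue and then increasing \<open>i\<close>, the family for \<open>n + 1\<close> arises from the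
  family \<open>f\<close> for \<open>n\<close> by sums \<open>x P + H\<close> of a prefix sum \<open>P\<close> and the complementary suffix sum \<open>H\<close>
  of \<open>f\<close>, and such sums preserve interlacing. As \<open>D\<^sub>n\<^sub>,\<^sub>r(h)\<close> is the combination of the last
  \<open>n + 1\<close> members (residue \<open>0\<close>) with weights \<open>c\<^sub>i\<close>, part (a) follows.

  For part (b), let \<open>P\<^sub>i\<close>, \<open>H\<^sub>i\<close> be the prefix and suffix sums of the family for \<open>n - 1\<close> for which
  \<open>D\<^sub>n\<^sub>,\<^sub>r(x\<^sup>i) = x P\<^sub>i + H\<^sub>i\<close>. Then \<open>a = \<Sum> c\<^sub>i H\<^sub>i + x \<Sum> c\<^sub>n\<^sub>-\<^sub>i P\<^sub>i\<close> and
  \<open>b = \<Sum> (c\<^sub>i - c\<^sub>n\<^sub>-\<^sub>i) P\<^sub>i\<close>; summation by parts turns the hypothesis on \<open>c\<close> into nonnegativity of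
  the weights of \<open>b\<close> in the family itself.
\<close>

section \<open>Stability and interlacing in the upper half-plane\<close>

abbreviation cpoly :: "real poly \<Rightarrow> complex \<Rightarrow> complex" where
  "cpoly p z \<equiv> poly (map_poly complex_of_real p) z"

lemma cpoly_add: "cpoly (p + q) z = cpoly p z + cpoly q z"
proof -
  have "map_poly complex_of_real (p + q) = map_poly complex_of_real p + map_poly complex_of_real q"
    by (rule poly_eqI) (simp add: coeff_map_poly)
  then show ?thesis by simp
qed

lemma cpoly_smult: "cpoly (smult c p) z = of_real c * cpoly p z"
proof -
  have "map_poly complex_of_real (smult c p) = smult (of_real c) (map_poly complex_of_real p)"
    by (rule poly_eqI) (simp add: coeff_map_poly)
  then show ?thesis by simp
qed

lemma cpoly_pCons: "cpoly (pCons c p) z = of_real c + z * cpoly p z"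
  by (simp add: map_poly_pCons)

lemma cpoly_cnj: "cpoly p (cnj z) = cnj (cpoly p z)"
  by (induction p) (simp_all add: cpoly_pCons)

text \<open>The zero polynomial counts as stable, so that empty sums and vanishing weights need no
  separate treatment.\<close>

definition upper_stable :: "real poly \<Rightarrow> bool" where
  "upper_stable p \<longleftrightarrow> (\<forall>z. Im z > 0 \<longrightarrow> cpoly p z = 0 \<longrightarrow> p = 0)"

text \<open>
  For polynomials with nonnegative coefficients this is interlacing of zeros, phrased as
  \<open>0 \<le> arg (g(z) / f(z)) \<le> arg z\<close> in the upper half-plane. In this form it is evidently closed
  under sums on either side, and pairwise relations suffice, so transitivity is never needed.
\<close>

definition interlaces :: "real poly \<Rightarrow> real poly \<Rightarrow> bool" (infix "\<lless>" 50) where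
  "f \<lless> g \<longleftrightarrow> (\<forall>z. Im z > 0 \<longrightarrow>
     Im (cpoly g z * cnj (cpoly f z)) \<ge> 0 \<and> Im (z * cpoly f z * cnj (cpoly g z)) \<ge> 0)"

lemma upper_stable_imp_real_rooted:
  assumes "upper_stable p"
  shows "real_rooted p"
proof -
  have "z \<in> \<real>" if "p \<noteq> 0" "cpoly p z = 0" for z
  proof -
    have "Im z \<le> 0" "Im (cnj z) \<le> 0"
      using assms cpoly_cnj[of p z] that unfolding upper_stable_def
      by (metis complex_cnj_zero not_le)+
    then show ?thesis
      by (simp add: complex_is_Real_iff)
  qed
  then show ?thesis
    by (auto simp: real_rooted_def)
qed

lemma upper_stable_0 [simp]: "upper_stable 0" and upper_stable_1 [simp]: "upper_stable 1"
  by (auto simp: upper_stable_def)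

lemma upper_stable_shift: "upper_stable p \<Longrightarrow> upper_stable (pCons 0 p)"
  by (auto simp: upper_stable_def cpoly_pCons)

lemma upper_stable_smult: "upper_stable p \<Longrightarrow> upper_stable (smult c p)"
  by (auto simp: upper_stable_def cpoly_smult)

text \<open>Where \<open>g(z) = -f(z)\<close>, the second inequality of \<open>interlaces\<close>
  forces \<open>Im z * |f(z)|^2 \<le> 0\<close>. So both summands vanish at \<open>z\<close> and,
  being stable, are zero.\<close>

lemma upper_stable_add:
  assumes "f \<lless> g" "upper_stable f" "upper_stable g"
  shows "upper_stable (f + g)"
  unfolding upper_stable_def
proof (intro allI impI)
  fix z assume z: "Im z > 0" and "cpoly (f + g) z = 0"
  then have g: "cpoly g z = - cpoly f z"
    by (simp add: cpoly_add add_eq_0_iff)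
  have "Im (z * cpoly f z * cnj (cpoly g z)) \<ge> 0"
    using assms(1) z by (simp add: interlaces_def)
  then have "Im z * (norm (cpoly f z))\<^sup>2 \<le> 0"
    unfolding g by (simp add: cmod_def power2_eq_square algebra_simps)
  then have "cpoly f z = 0"
    using z by (simp add: mult_le_0_iff)
  then show "f + g = 0"
    using g assms(2,3) z by (auto simp: upper_stable_def)
qed

lemma interlaces_refl: "f \<lless> f"
proof -
  have "Im (z * cpoly f z * cnj (cpoly f z)) = Im z * (norm (cpoly f z))\<^sup>2" for z
    by (simp add: cmod_def power2_eq_square algebra_simps)
  then show ?thesis
    unfolding interlaces_def by simp
qed

lemma interlaces_0_left [simp]: "0 \<lless> f" and interlaces_0_right [simp]: "f \<lless> 0"
  by (simp_all add: interlaces_def)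

lemma interlaces_add_left: "f \<lless> h \<Longrightarrow> g \<lless> h \<Longrightarrow> f + g \<lless> h"
  unfolding interlaces_def cpoly_add complex_cnj_add distrib_left distrib_right plus_complex.sel
  by (metis add_nonneg_nonneg)

lemma interlaces_add_right: "f \<lless> g \<Longrightarrow> f \<lless> h \<Longrightarrow> f \<lless> g + h"
  unfolding interlaces_def cpoly_add complex_cnj_add distrib_left distrib_right plus_complex.sel
  by (metis add_nonneg_nonneg)

lemma interlaces_smult:
  assumes "f \<lless> g" "c \<ge> 0" "d \<ge> 0"
  shows "smult c f \<lless> smult d g"
  unfolding interlaces_def
proof (intro allI impI)
  fix z :: complex assume z: "Im z > 0"
  let ?F = "cpoly f z" and ?G = "cpoly g z"
  have "cpoly (smult d g) z * cnj (cpoly (smult c f) z) = of_real (c * d) * (?G * cnj ?F)"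
    "z * cpoly (smult c f) z * cnj (cpoly (smult d g) z) = of_real (c * d) * (z * ?F * cnj ?G)"
    by (simp_all add: cpoly_smult mult_ac)
  then show "0 \<le> Im (cpoly (smult d g) z * cnj (cpoly (smult c f) z)) \<and>
      0 \<le> Im (z * cpoly (smult c f) z * cnj (cpoly (smult d g) z))"
    using assms z unfolding interlaces_def
    by (simp only: Im_complex_of_real Re_complex_of_real times_complex.sel(2)[of "of_real _"])
       (simp add: mult_nonneg_nonneg)
qed

text \<open>Passing from \<open>f, g\<close> to \<open>g, x f\<close> swaps the two defining
  inequalities, up to the factor \<open>|z|^2\<close>.\<close>

lemma interlaces_shift_right:
  assumes "f \<lless> g"
  shows "g \<lless> pCons 0 f"
  unfolding interlaces_def
proof (intro allI impI)
  fix z :: complex assume z: "Im z > 0"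
  let ?F = "cpoly f z" and ?G = "cpoly g z"
  have "z * ?G * cnj (cpoly (pCons 0 f) z) = of_real ((norm z)\<^sup>2) * (?G * cnj ?F)"
    by (simp only: complex_norm_square) (simp add: cpoly_pCons mult_ac)
  then have "Im (z * ?G * cnj (cpoly (pCons 0 f) z)) = (norm z)\<^sup>2 * Im (?G * cnj ?F)"
    by (simp only: Im_complex_of_real Re_complex_of_real times_complex.sel(2)[of "of_real _"])
  then show "0 \<le> Im (cpoly (pCons 0 f) z * cnj ?G) \<and> 0 \<le> Im (z * ?G * cnj (cpoly (pCons 0 f) z))"
    using assms z unfolding interlaces_def by (simp add: cpoly_pCons)
qed

text \<open>Both imaginary parts expand into nonnegative multiples of the two that the assumption
  controls, plus \<open>Im z\<close> times a squared modulus.\<close>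

lemma interlaces_exchange:
  assumes "m \<lless> u"
  shows "u + m \<lless> u + pCons 0 m"
  unfolding interlaces_def
proof (intro allI impI)
  fix z :: complex assume z: "Im z > 0"
  define U M where "U = cpoly u z" and "M = cpoly m z"
  have UM: "Im (U * cnj M) \<ge> 0" "Im (z * M * cnj U) \<ge> 0"
    using assms z by (simp_all add: interlaces_def U_def M_def)
  have "Im ((U + z * M) * cnj (U + M)) =
      Im (U * cnj M) + Im (z * M * cnj U) + Im z * (norm M)\<^sup>2"
    by (simp add: cmod_def power2_eq_square algebra_simps)
  moreover have "Im (z * (U + M) * cnj (U + z * M)) =
      Im z * (norm U)\<^sup>2 + (norm z)\<^sup>2 * Im (U * cnj M) + Im (z * M * cnj U)"
    by (simp add: cmod_def power2_eq_square algebra_simps)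
  ultimately show "0 \<le> Im (cpoly (u + pCons 0 m) z * cnj (cpoly (u + m) z)) \<and>
     0 \<le> Im (z * cpoly (u + m) z * cnj (cpoly (u + pCons 0 m) z))"
    using UM z by (simp add: cpoly_add cpoly_pCons U_def M_def)
qed

lemma interlaces_sum_left:
  assumes "\<And>i. i \<in> A \<Longrightarrow> f i \<lless> g"
  shows "sum f A \<lless> g"
  using assms by (induction A rule: infinite_finite_induct) (auto intro: interlaces_add_left)

lemma interlaces_sum_right:
  assumes "\<And>i. i \<in> A \<Longrightarrow> f \<lless> g i"
  shows "f \<lless> sum g A"
  using assms by (induction A rule: infinite_finite_induct) (auto intro: interlaces_add_right)

section \<open>Block sums of interlacing sequences\<close>

definition interlacing_seq :: "(nat \<Rightarrow> real poly) \<Rightarrow> nat \<Rightarrow> bool" where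
  "interlacing_seq f N \<longleftrightarrow>
     (\<forall>p<N. upper_stable (f p)) \<and> (\<forall>p q. p \<le> q \<longrightarrow> q < N \<longrightarrow> f p \<lless> f q)"

lemma interlacing_seq_smult:
  assumes "interlacing_seq f N" "\<And>p. p < N \<Longrightarrow> c p \<ge> 0"
  shows "interlacing_seq (\<lambda>p. smult (c p) (f p)) N"
  using assms by (auto simp: interlacing_seq_def intro!: upper_stable_smult interlaces_smult)

lemma interlacing_seq_sum:
  assumes "interlacing_seq f N" "t \<le> N"
  shows "upper_stable (\<Sum>p=s..<t. f p)"
  using assms(2)
proof (induction t)
  case (Suc t)
  show ?case
  proof (cases "s \<le> t")
    case True
    have "(\<Sum>p=s..<t. f p) \<lless> f t"
      using assms Suc.prems by (auto simp: interlacing_seq_def intro!: interlaces_sum_left)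
    then show ?thesis
      using True Suc assms by (auto simp: interlacing_seq_def intro!: upper_stable_add)
  qed simp
qed simp

lemma interlacing_seq_blocks:
  assumes "interlacing_seq f N" "t \<le> s'" "t' \<le> N"
  shows "(\<Sum>p=s..<t. f p) \<lless> (\<Sum>p=s'..<t'. f p)"
  using assms by (auto simp: interlacing_seq_def intro!: interlaces_sum_left interlaces_sum_right)

text \<open>Prefix and suffix may overlap; the overlap occurs on both sides and is compared with
  itself by reflexivity.\<close>

lemma interlacing_seq_prefix_suffix:
  assumes f: "interlacing_seq f N" and "s \<le> N" "t \<le> N"
  shows "(\<Sum>p<s. f p) \<lless> (\<Sum>p=t..<N. f p)"
proof (cases "s \<le> t")
  case True
  then show ?thesis
    using interlacing_seq_blocks[OF f, of s t N 0] by (simp add: lessThan_atLeast0)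
next
  case False
  have 1: "(\<Sum>p<s. f p) = (\<Sum>p=0..<t. f p) + (\<Sum>p=t..<s. f p)"
    and 2: "(\<Sum>p=t..<N. f p) = (\<Sum>p=t..<s. f p) + (\<Sum>p=s..<N. f p)"
    using False assms by (simp_all add: lessThan_atLeast0 sum.atLeastLessThan_concat)
  show ?thesis
    unfolding 1 2 using False assms
    by (intro interlaces_add_left interlaces_add_right interlaces_refl interlacing_seq_blocks[OF f])
       simp_all
qed

lemma interlacing_seq_prefixes:
  assumes "interlacing_seq f N" "s \<le> t" "t \<le> N"
  shows "(\<Sum>p<s. f p) \<lless> (\<Sum>p<t. f p)"
proof -
  have 1: "(\<Sum>p<t. f p) = (\<Sum>p=0..<s. f p) + (\<Sum>p=s..<t. f p)"
    using assms by (simp add: lessThan_atLeast0 sum.atLeastLessThan_concat)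
  show ?thesis
    unfolding 1 unfolding lessThan_atLeast0 using assms
    by (intro interlaces_add_right interlaces_refl interlacing_seq_blocks) simp_all
qed

lemma interlacing_seq_suffixes:
  assumes "interlacing_seq f N" "s \<le> t" "t \<le> N"
  shows "(\<Sum>p=s..<N. f p) \<lless> (\<Sum>p=t..<N. f p)"
proof -
  have 1: "(\<Sum>p=s..<N. f p) = (\<Sum>p=s..<t. f p) + (\<Sum>p=t..<N. f p)"
    using assms by (simp add: sum.atLeastLessThan_concat)
  show ?thesis
    unfolding 1 using assms
    by (intro interlaces_add_left interlaces_refl interlacing_seq_blocks[of f N]) simp_all
qed

section \<open>Shifted sums\<close>

definition shifted_sum :: "(nat \<Rightarrow> real poly) \<Rightarrow> nat \<Rightarrow> nat \<Rightarrow> real poly" where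
  "shifted_sum f N s = pCons 0 (\<Sum>p<s. f p) + (\<Sum>p=s..<N. f p)"

lemma upper_stable_shifted_sum:
  assumes f: "interlacing_seq f N" and "s \<le> N"
  shows "upper_stable (shifted_sum f N s)"
proof -
  have "(\<Sum>p=s..<N. f p) \<lless> pCons 0 (\<Sum>p<s. f p)"
    using assms by (intro interlaces_shift_right interlacing_seq_prefix_suffix) auto
  moreover have "upper_stable (\<Sum>p=s..<N. f p)" "upper_stable (pCons 0 (\<Sum>p<s. f p))"
    unfolding lessThan_atLeast0 using assms
    by (auto intro: upper_stable_shift interlacing_seq_sum)
  ultimately show ?thesis
    unfolding shifted_sum_def by (metis add.commute upper_stable_add)
qed

text \<open>Raising the cut from \<open>s\<close> to \<open>t\<close> only moves the block
  \<open>m\<close> between them behind the factor \<open>x\<close>; the rest \<open>u\<close> is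
  common to both sums.\<close>

lemma interlaces_shifted_sum:
  assumes f: "interlacing_seq f N" and "s \<le> t" "t \<le> N"
  shows "shifted_sum f N s \<lless> shifted_sum f N t"
proof -
  define m u where "m = (\<Sum>p=s..<t. f p)" and "u = (\<Sum>p=t..<N. f p) + pCons 0 (\<Sum>p=0..<s. f p)"
  have "m \<lless> u"
    unfolding m_def u_def using assms
    by (intro interlaces_add_right interlaces_shift_right interlacing_seq_blocks[OF f]) simp_all
  moreover have "(\<Sum>p=s..<N. f p) = m + (\<Sum>p=t..<N. f p)"
    "(\<Sum>p<t. f p) = (\<Sum>p=0..<s. f p) + m"
    using assms by (simp_all add: m_def lessThan_atLeast0 sum.atLeastLessThan_concat)
  then have "shifted_sum f N s = u + m" "shifted_sum f N t = u + pCons 0 m"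
    by (simp_all add: shifted_sum_def u_def lessThan_atLeast0)
  ultimately show ?thesis
    using interlaces_exchange by simp
qed

section \<open>The recursive family of section polynomials\<close>

text \<open>
  Position \<open>c (n + 1) + i\<close> with \<open>i \<le> n\<close> stands for residue \<open>s - c\<close> modulo \<open>s + 1\<close> and basis
  polynomial \<open>x\<^sup>i (1 + x)\<^sup>n\<^sup>-\<^sup>i\<close>; only positions below \<open>(s + 1) (n + 1)\<close> are meaningful.
\<close>

primrec section_poly :: "nat \<Rightarrow> nat \<Rightarrow> nat \<Rightarrow> real poly" where
  "section_poly s 0 = (\<lambda>p. if p = s then 1 else 0)"
| "section_poly s (Suc n) =
     (\<lambda>q. shifted_sum (section_poly s n) (Suc s * Suc n) (q - q div Suc (Suc n)))"

text \<open>Computes the cut used in \<open>section_poly\<close>. The last offset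
  \<open>i = m\<close> of a block has the same cut as the first offset of the next block.\<close>

lemma diff_div_Suc_eq:
  assumes "i < Suc m"
  shows "(c * Suc m + i) - (c * Suc m + i) div Suc m = c * m + i"
proof -
  have "(c * Suc m + i) div Suc m = c"
    using assms by (intro div_nat_eqI) auto
  then show ?thesis by simp
qed

lemma diff_div_Suc_decomp: "q - q div Suc m = q div Suc m * m + q mod Suc m"
  using diff_div_Suc_eq[of "q mod Suc m" m "q div Suc m"] by (simp del: mult_Suc_right)

lemma diff_div_Suc_mono:
  assumes "p \<le> (q::nat)"
  shows "p - p div Suc m \<le> q - q div Suc m"
  using assms
proof (induction q rule: dec_induct)
  case (step q)
  then show ?case
    by (cases "Suc (q mod Suc m) = Suc m") (auto simp: div_Suc)
qed simp

lemma diff_div_Suc_le: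
  assumes "q < c * Suc m"
  shows "q - q div Suc m \<le> c * m"
  using diff_div_Suc_mono[of q "c * Suc m" m] diff_div_Suc_eq[of 0 m c] assms
  by (simp del: mult_Suc_right)

lemma section_poly_interlacing: "interlacing_seq (section_poly s n) (Suc s * Suc n)"
proof (induction n)
  case 0
  then show ?case
    by (auto simp: interlacing_seq_def interlaces_refl)
next
  case (Suc n)
  have "q - q div Suc (Suc n) \<le> Suc s * Suc n" if "q < Suc s * Suc (Suc n)" for q
    using diff_div_Suc_le[OF that] .
  then show ?case
    unfolding interlacing_seq_def section_poly.simps
    by (intro conjI allI impI upper_stable_shifted_sum[OF Suc.IH] interlaces_shifted_sum[OF Suc.IH]
        diff_div_Suc_mono) auto
qed

lemma nonneg_coeffs_add: "nonneg_coeffs p \<Longrightarrow> nonneg_coeffs q \<Longrightarrow> nonneg_coeffs (p + q)"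
  by (simp add: nonneg_coeffs_def)

lemma nonneg_coeffs_sum: "(\<And>i. i \<in> A \<Longrightarrow> nonneg_coeffs (f i)) \<Longrightarrow> nonneg_coeffs (sum f A)"
  by (simp add: nonneg_coeffs_def coeff_sum sum_nonneg)

lemma nonneg_coeffs_shift: "nonneg_coeffs p \<Longrightarrow> nonneg_coeffs (pCons 0 p)"
  by (simp add: nonneg_coeffs_def coeff_pCons split: nat.split)

lemma nonneg_coeffs_smult: "nonneg_coeffs p \<Longrightarrow> c \<ge> 0 \<Longrightarrow> nonneg_coeffs (smult c p)"
  by (simp add: nonneg_coeffs_def)

lemma section_poly_nonneg: "nonneg_coeffs (section_poly s n p)"
proof (induction n arbitrary: p)
  case 0
  then show ?case by (simp add: nonneg_coeffs_def)
next
  case (Suc n)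
  then show ?case
    by (simp add: shifted_sum_def nonneg_coeffs_add nonneg_coeffs_sum nonneg_coeffs_shift)
qed

lemma degree_section_poly: "degree (section_poly s n p) \<le> n"
proof (induction n arbitrary: p)
  case (Suc n)
  have "degree (\<Sum>p\<in>A. section_poly s n p) \<le> n" for A
    by (cases "finite A") (auto intro: degree_sum_le Suc)
  then show ?case
    unfolding section_poly.simps shifted_sum_def
    by (intro degree_add_le order.trans[OF degree_pCons_le]) (simp_all only: Suc_le_mono le_SucI)
qed simp


section \<open>Reversal of coefficients\<close>

lemma section_poly_last_block:
  assumes "i \<le> Suc n"
  shows "section_poly s (Suc n) (s * Suc (Suc n) + i) =
    shifted_sum (section_poly s n) (Suc s * Suc n) (s * Suc n + i)"
  using diff_div_Suc_eq[of i "Suc n" s] assms by simp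

lemma sum_reflect:
  fixes F :: "nat \<Rightarrow> 'a::comm_monoid_add"
  assumes "b \<le> K"
  shows "(\<Sum>p=a..<b. F (K - Suc p)) = (\<Sum>p=K-b..<K-a. F p)"
  by (rule sum.reindex_bij_witness[of _ "\<lambda>p. K - Suc p" "\<lambda>p. K - Suc p"]) (use assms in auto)

lemma poly_shifted_sum:
  "poly (shifted_sum f N t) x = x * (\<Sum>p=0..<t. poly (f p) x) + (\<Sum>p=t..<N. poly (f p) x)"
  by (simp add: shifted_sum_def poly_sum lessThan_atLeast0)

lemma poly_shifted_sum_inverse:
  assumes "x \<noteq> (0::real)"
  shows "x ^ Suc n * poly (shifted_sum f N t) (1 / x) =
    (\<Sum>p=0..<t. x ^ n * poly (f p) (1 / x)) + x * (\<Sum>p=t..<N. x ^ n * poly (f p) (1 / x))"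
  using assms by (simp add: poly_shifted_sum sum_distrib_left[symmetric] algebra_simps)

text \<open>Reversal mirrors the last block in itself, and the positions before it among themselves
  at the price of a factor \<open>x\<close>. Summed over blocks, this turns a cut
  \<open>t \<le> M\<close> into \<open>M - t\<close> with a factor \<open>x\<close>, and a cut
  \<open>t \<ge> M\<close> into \<open>N + M - t\<close>.\<close>

lemma section_poly_reciprocal:
  assumes x: "x \<noteq> 0"
  shows "p < s * Suc n \<Longrightarrow>
      x ^ n * poly (section_poly s n p) (1 / x) = x * poly (section_poly s n (s * Suc n - Suc p)) x"
    and "i \<le> n \<Longrightarrow>
      x ^ n * poly (section_poly s n (s * Suc n + i)) (1 / x) =
        poly (section_poly s n (s * Suc n + (n - i))) x"
proof (induction n arbitrary: p i)
  case 0
  {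
    case 1
    then show ?case by simp
  next
    case 2
    then show ?case by simp
  }
next
  case (Suc n)
  define M N where "M = s * Suc n" and "N = Suc s * Suc n"
  have N: "N = M + Suc n"
    by (simp add: M_def N_def)
  define F where "F p = poly (section_poly s n p) x" for p
  define G where "G p = x ^ n * poly (section_poly s n p) (1 / x)" for p
  have low: "(\<Sum>p=a..<b. G p) = x * (\<Sum>p=M-b..<M-a. F p)" if "b \<le> M" for a b
  proof -
    have "(\<Sum>p=a..<b. G p) = (\<Sum>p=a..<b. x * F (M - Suc p))"
      using that Suc.IH(1) by (intro sum.cong) (auto simp: G_def F_def M_def)
    then show ?thesis
      using sum_reflect[OF that, of F a] by (simp flip: sum_distrib_left)
  qed
  have high: "(\<Sum>p=a..<b. G p) = (\<Sum>p=N+M-b..<N+M-a. F p)" if "M \<le> a" "b \<le> N" for a b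
  proof -
    have "G p = F (N + M - Suc p)" if "a \<le> p" "p < b" for p
    proof -
      define i where "i = p - M"
      have "p = M + i" "i \<le> n"
        using that \<open>M \<le> a\<close> \<open>b \<le> N\<close> unfolding i_def N by linarith+
      moreover from this have "N + M - Suc p = M + (n - i)"
        unfolding N by linarith
      ultimately show ?thesis
        using Suc.IH(2)[of i] by (simp add: G_def F_def M_def)
    qed
    then have "(\<Sum>p=a..<b. G p) = (\<Sum>p=a..<b. F (N + M - Suc p))"
      by (intro sum.cong) auto
    then show ?thesis
      using sum_reflect[of b "N + M" F a] that by simp
  qed
  have reverse: "x ^ Suc n * poly (shifted_sum (section_poly s n) N t) (1 / x) =
      (\<Sum>p=0..<t. G p) + x * (\<Sum>p=t..<N. G p)" for t
    unfolding G_def by (rule poly_shifted_sum_inverse[OF x])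
  have forward: "poly (shifted_sum (section_poly s n) N t) x =
      x * (\<Sum>p=0..<t. F p) + (\<Sum>p=t..<N. F p)" for t
    unfolding F_def by (rule poly_shifted_sum)
  {
    case 1
    define c i where "c = p div Suc (Suc n)" and "i = p mod Suc (Suc n)"
    have p: "p = c * Suc (Suc n) + i" and i: "i \<le> Suc n"
      unfolding c_def i_def using mod_less_divisor[of "Suc (Suc n)" p]
      by (simp_all only: div_mult_mod_eq zero_less_Suc simp_thms less_Suc_eq_le)
    have "c < s"
      unfolding c_def using 1 by (simp add: less_mult_imp_div_less)
    \<comment> \<open>Block \<open>e\<close> contains the mirror image of position \<open>p\<close>,
      at offset \<open>Suc n - i\<close>.\<close>
    then obtain e where s: "s = Suc (c + e)"
      using less_imp_Suc_add by blast
    define t where "t = c * Suc n + i"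
    have t: "t \<le> M" "M - t = e * Suc n + (Suc n - i)"
      using i by (simp_all add: t_def M_def s algebra_simps)
    have "s * Suc (Suc n) - Suc p = e * Suc (Suc n) + (Suc n - i)"
      using i by (simp add: p s algebra_simps)
    then have q: "section_poly s (Suc n) (s * Suc (Suc n) - Suc p) =
        shifted_sum (section_poly s n) N (M - t)"
      using diff_div_Suc_eq[of "Suc n - i" "Suc n" e] by (simp add: t N_def)
    have p: "section_poly s (Suc n) p = shifted_sum (section_poly s n) N t"
      using diff_div_Suc_eq[of i "Suc n" c] i by (simp add: p t_def N_def)
    have 1: "(\<Sum>p=t..<N. G p) = (\<Sum>p=t..<M. G p) + (\<Sum>p=M..<N. G p)"
      and 2: "(\<Sum>p=M-t..<N. F p) = (\<Sum>p=M-t..<M. F p) + (\<Sum>p=M..<N. F p)"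
      using t by (simp_all add: sum.atLeastLessThan_concat N)
    show ?case
      unfolding p q reverse forward 1 2 low[OF t(1)] low[OF order.refl] high[OF order.refl order.refl]
      by (simp add: algebra_simps)
  next
    case (2 i)
    define j where "j = Suc n - i"
    have j: "j \<le> Suc n" "N + M - (M + i) = M + j" "N = M + i + j"
      using 2 by (simp_all add: j_def N)
    have 1: "(\<Sum>p=0..<M+k. E p) = (\<Sum>p=0..<M. E p) + (\<Sum>p=M..<M+k. E p)"
      for k and E :: "nat \<Rightarrow> real"
      by (simp add: sum.atLeastLessThan_concat)
    have "(\<Sum>p=M..<M+i. G p) = (\<Sum>p=M+j..<N. F p)" "(\<Sum>p=M+i..<N. G p) = (\<Sum>p=M..<M+j. F p)"
      "(\<Sum>p=0..<M. G p) = x * (\<Sum>p=0..<M. F p)"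
      using high[of M "M + i"] high[of "M + i" N] low[of M 0] j by (simp_all add: add.commute)
    then show ?case
      unfolding j_def[symmetric] section_poly_last_block[OF 2] section_poly_last_block[OF j(1)]
        N_def[symmetric] M_def[symmetric] reverse forward 1
      by (simp add: algebra_simps)
  }
qed

section \<open>Generating series of the sections\<close>

text \<open>
  Truncating at negative arguments makes the initial coefficient \<open>f(0)\<close> of the series a backward
  difference like all others.
\<close>

definition trunc_basis :: "nat \<Rightarrow> nat \<Rightarrow> int \<Rightarrow> real" where
  "trunc_basis n i t = (if t < 0 then 0 else of_int t ^ i * (1 + of_int t) ^ (n - i))"

definition basis_diff :: "nat \<Rightarrow> nat \<Rightarrow> int \<Rightarrow> real" where
  "basis_diff n i t = trunc_basis n i t - trunc_basis n i (t - 1)"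

text \<open>Multiply the basis polynomial by \<open>1 = (1 + x) - x\<close>.\<close>

lemma basis_diff_step:
  assumes "i \<le> n"
  shows "basis_diff n i t = basis_diff (Suc n) i t - basis_diff (Suc n) (Suc i) t"
proof -
  have "trunc_basis n i t = trunc_basis (Suc n) i t - trunc_basis (Suc n) (Suc i) t" for t
    using assms by (simp add: trunc_basis_def Suc_diff_le algebra_simps)
  then show ?thesis by (simp add: basis_diff_def)
qed

text \<open>Both sides come from the power \<open>t ^ Suc n\<close>. At \<open>t = 0\<close> the
  truncation is harmless because the exponent is positive.\<close>

lemma basis_diff_wrap: "basis_diff (Suc n) (Suc n) t = basis_diff (Suc n) 0 (t - 1)"
proof -
  have "trunc_basis (Suc n) (Suc n) t = trunc_basis (Suc n) 0 (t - 1)" for t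
    by (cases "t = 0") (auto simp: trunc_basis_def)
  then show ?thesis by (simp add: basis_diff_def)
qed

text \<open>The subtraction is one of integers, since \<open>c = Suc s\<close> occurs when the last
  block wraps around; the arguments then start at \<open>-1\<close>.\<close>

definition section_fps :: "nat \<Rightarrow> nat \<Rightarrow> nat \<Rightarrow> nat \<Rightarrow> real fps" where
  "section_fps s n c i = Abs_fps (\<lambda>m. basis_diff n i (int (Suc s * m + s) - int c))"

lemma section_fps_step:
  assumes "i \<le> n"
  shows "section_fps s n c i = section_fps s (Suc n) c i - section_fps s (Suc n) c (Suc i)"
  by (rule fps_ext) (simp add: section_fps_def basis_diff_step[OF assms])

lemma section_fps_wrap: "section_fps s (Suc n) c (Suc n) = section_fps s (Suc n) (Suc c) 0"
proof (rule fps_ext)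
  fix m
  have "int (Suc s * m + s) - int c - 1 = int (Suc s * m + s) - int (Suc c)"
    by simp
  then show "fps_nth (section_fps s (Suc n) c (Suc n)) m = fps_nth (section_fps s (Suc n) (Suc c) 0) m"
    by (simp only: section_fps_def fps_nth_Abs_fps basis_diff_wrap)
qed

lemma fps_of_poly_section_poly:
  "p < Suc s * Suc n \<Longrightarrow>
   fps_of_poly (section_poly s n p) = section_fps s n (p div Suc n) (p mod Suc n) * (1 - fps_X) ^ n"
proof (induction n arbitrary: p)
  case 0
  have "basis_diff 0 0 (int (Suc s * m + s) - int p) = (if m = 0 \<and> p = s then 1 else 0)" for m
  proof -
    have "Suc s * m + s = p \<longleftrightarrow> m = 0 \<and> p = s"
      using 0 by (cases m) auto
    then have "int (Suc s * m + s) - int p = 0 \<longleftrightarrow> m = 0 \<and> p = s"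
      by linarith
    then show ?thesis
      by (auto simp: basis_diff_def trunc_basis_def)
  qed
  then show ?case
    by (simp add: section_fps_def fps_eq_iff del: of_nat_add of_nat_mult of_nat_Suc mult_Suc)
next
  case (Suc n)
  define N where "N = Suc s * Suc n"
  \<comment> \<open>The family for \<open>n\<close> is the sequence of consecutive differences of \<open>Q\<close>, so its block sums telescope.\<close>
  define Q where "Q p = section_fps s (Suc n) (p div Suc n) (p mod Suc n)" for p
  \<comment> \<open>A full round through the blocks lowers every argument by \<open>Suc s\<close>,
    which shifts the series by one index.\<close>
  have QN: "Q N = fps_X * Q 0"
  proof (rule fps_ext)
    fix m
    have "basis_diff (Suc n) 0 (-1) = 0"
      by (simp add: basis_diff_def trunc_basis_def)
    moreover have "N div Suc n = Suc s" "N mod Suc n = 0"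
      unfolding N_def by (simp_all only: nonzero_mult_div_cancel_right mod_mult_self2_is_0)
    ultimately show "fps_nth (Q N) m = fps_nth (fps_X * Q 0) m"
      by (cases m) (simp_all add: Q_def section_fps_def algebra_simps)
  qed
  have Q_step: "section_fps s n (p div Suc n) (p mod Suc n) = Q p - Q (Suc p)" for p
  proof (cases "Suc (p mod Suc n) = Suc n")
    case True
    then have "Suc p mod Suc n = 0" "Suc p div Suc n = Suc (p div Suc n)" "p mod Suc n = n"
      by (auto simp: mod_Suc div_Suc)
    then show ?thesis
      using section_fps_step[of n n] section_fps_wrap by (simp add: Q_def)
  next
    case False
    then have "Suc p mod Suc n = Suc (p mod Suc n)" "Suc p div Suc n = p div Suc n"
      by (auto simp: mod_Suc div_Suc)
    moreover have "p mod Suc n \<le> n"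
      by (metis less_Suc_eq_le mod_less_divisor zero_less_Suc)
    ultimately show ?thesis
      using section_fps_step[of "p mod Suc n" n] by (simp add: Q_def)
  qed
  have sums: "(\<Sum>p=a..<b. fps_of_poly (section_poly s n p)) = (Q a - Q b) * (1 - fps_X) ^ n"
    if "a \<le> b" "b \<le> N" for a b
  proof -
    have "(\<Sum>p=a..<b. fps_of_poly (section_poly s n p)) =
        (\<Sum>p=a..<b. (Q p - Q (Suc p)) * (1 - fps_X) ^ n)"
      using that Suc.IH by (intro sum.cong) (auto simp: N_def Q_step)
    also have "\<dots> = - (\<Sum>p=a..<b. Q (Suc p) - Q p) * (1 - fps_X) ^ n"
      by (simp add: sum_distrib_right[symmetric] sum_subtractf)
    finally show ?thesis
      using that by (simp add: sum_Suc_diff' algebra_simps)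
  qed
  define t where "t = p - p div Suc (Suc n)"
  define c i where "c = p div Suc (Suc n)" and "i = p mod Suc (Suc n)"
  have i: "i \<le> Suc n"
    unfolding i_def by (metis less_Suc_eq_le mod_less_divisor zero_less_Suc)
  have t: "t \<le> N"
    using diff_div_Suc_le[OF Suc.prems] by (simp add: t_def N_def)
  have "fps_of_poly (section_poly s (Suc n) p) =
      fps_X * ((Q 0 - Q t) * (1 - fps_X) ^ n) + (Q t - Q N) * (1 - fps_X) ^ n"
    using sums[of 0 t] sums[of t N] t
    unfolding section_poly.simps shifted_sum_def lessThan_atLeast0 t_def[symmetric] N_def[symmetric]
    by (simp add: fps_of_poly_add fps_of_poly_pCons fps_of_poly_sum mult.commute)
  \<comment> \<open>The term \<open>fps_X * Q 0\<close> cancels against \<open>Q N\<close>, leaving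
    \<open>Q t - fps_X * Q t\<close>: one further factor \<open>1 - fps_X\<close>.\<close>
  also have "\<dots> = Q t * (1 - fps_X) ^ Suc n"
    unfolding QN by (simp add: algebra_simps)
  also have "Q t = section_fps s (Suc n) c i"
  proof (cases "i = Suc n")
    case True
    then have "t = Suc c * Suc n"
      using diff_div_Suc_decomp[of p "Suc n"] by (simp add: t_def c_def i_def)
    then have "t div Suc n = Suc c" "t mod Suc n = 0"
      by (simp_all del: mult_Suc mult_Suc_right)
    then show ?thesis
      using True section_fps_wrap by (simp add: Q_def)
  next
    case False
    have "t = c * Suc n + i"
      unfolding t_def c_def i_def by (rule diff_div_Suc_decomp)
    moreover have "i < Suc n"
      using False i by simp
    ultimately have "t div Suc n = c" "t mod Suc n = i"
      by (simp_all del: mult_Suc mult_Suc_right)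
    then show ?thesis
      by (simp add: Q_def)
  qed
  finally show ?case
    by (simp add: c_def i_def)
qed

section \<open>The operator as a combination of sections\<close>

lemma poly_h_to_f:
  "poly (h_to_f n h) x = (\<Sum>i\<le>n. coeff h i * (x ^ i * (1 + x) ^ (n - i)))"
  by (simp add: h_to_f_def poly_sum poly_monom mult.assoc)

text \<open>In the last block the arguments are exactly \<open>Suc s * m\<close>, so its weighted
  series is \<open>D_series\<close>; uniqueness of the numerator does the rest.\<close>

lemma D_op_eq:
  "D_op n (Suc s) h = (\<Sum>i\<le>n. smult (coeff h i) (section_poly s n (s * Suc n + i)))" (is "_ = ?D")
  unfolding D_op_def
proof (rule the1_equality[OF D_op_ex1], intro conjI)
  show "degree ?D \<le> n"
    by (intro degree_sum_le) (auto intro: order.trans[OF degree_smult_le] degree_section_poly)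
  have "fps_of_poly (section_poly s n (s * Suc n + i)) = section_fps s n s i * (1 - fps_X) ^ n"
    if "i \<le> n" for i
  proof -
    have "(s * Suc n + i) div Suc n = s" "(s * Suc n + i) mod Suc n = i"
      using that by (simp_all del: mult_Suc_right)
    then show ?thesis
      using fps_of_poly_section_poly[of "s * Suc n + i" s n] that by simp
  qed
  then have "fps_of_poly ?D =
      (\<Sum>i\<le>n. fps_const (coeff h i) * section_fps s n s i) * (1 - fps_X) ^ n"
    by (simp add: fps_of_poly_sum fps_of_poly_smult sum_distrib_right mult.assoc)
  also have "(\<Sum>i\<le>n. fps_const (coeff h i) * section_fps s n s i) = D_series n (Suc s) h"
  proof (rule fps_ext)
    fix m
    have nth: "fps_nth (\<Sum>i\<le>n. fps_const (coeff h i) * section_fps s n s i) m =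
        (\<Sum>i\<le>n. coeff h i * basis_diff n i (int (Suc s * m)))"
      by (simp add: fps_sum_nth section_fps_def)
    show "fps_nth (\<Sum>i\<le>n. fps_const (coeff h i) * section_fps s n s i) m =
        fps_nth (D_series n (Suc s) h) m"
    proof (cases "m = 0")
      case True
      then show ?thesis
        unfolding nth by (simp add: D_series_def poly_h_to_f basis_diff_def trunc_basis_def)
    next
      case False
      define T where "T = Suc s * m"
      have "T \<noteq> 0" using False by (simp add: T_def)
      then have "basis_diff n i (int T) =
          real T ^ i * (1 + real T) ^ (n - i) - (real T - 1) ^ i * (1 + (real T - 1)) ^ (n - i)" for i
        by (simp add: basis_diff_def trunc_basis_def)
      then show ?thesis
        unfolding nth using False
        by (simp add: D_series_def poly_h_to_f T_def[symmetric] sum_subtractf[symmetric]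
            right_diff_distrib del: mult_Suc)
    qed
  qed
  finally have "fps_of_poly ?D = D_series n (Suc s) h * (1 - fps_X) ^ n" .
  moreover have "(1 - fps_X :: real fps) ^ n \<noteq> 0"
    by (metis fps_X_neq_one power_not_zero right_minus_eq)
  ultimately show "D_series n (Suc s) h = fps_of_poly ?D / (1 - fps_X) ^ n"
    by simp
qed

text \<open>Serves both for \<open>D_op\<close> with the coefficients of \<open>h\<close> and for
  the component \<open>b\<close> with the weights \<open>\<beta>\<close>.\<close>

lemma section_poly_combination_upper_stable:
  assumes "\<And>i. i \<le> n \<Longrightarrow> c i \<ge> 0"
  shows "upper_stable (\<Sum>i\<le>n. smult (c i) (section_poly s n (s * Suc n + i)))"
proof -
  have "interlacing_seq (\<lambda>i. smult (c i) (section_poly s n (s * Suc n + i))) (Suc n)"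
    using section_poly_interlacing[of s n] assms
    by (auto simp: interlacing_seq_def intro!: upper_stable_smult interlaces_smult)
  from interlacing_seq_sum[OF this order.refl, of 0] show ?thesis
    by (simp only: lessThan_Suc_atMost[symmetric] lessThan_atLeast0)
qed


section \<open>The symmetric decomposition\<close>

lemma symmetric_decomposition_D_op:
  fixes h :: "real poly" and s k :: nat
  defines "c \<equiv> coeff h" and "n \<equiv> Suc k"
  assumes h: "nonneg_coeffs h"
    and le: "\<And>i. i \<le> n div 2 \<Longrightarrow> (\<Sum>j\<le>i. c j) \<le> (\<Sum>j\<le>i. c (n - j))"
  shows "\<exists>a b. symmetric_decomposition n (D_op n (Suc s) h) a b \<and>
             nonneg_coeffs a \<and> nonneg_coeffs b \<and> real_rooted a \<and> real_rooted b"
proof -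
  define f M N where "f = section_poly s k" and "M = s * Suc k" and "N = Suc s * Suc k"
  have N: "N = M + n"
    by (simp add: N_def M_def n_def)
  have c: "c i \<ge> 0" for i
    using h by (simp add: c_def nonneg_coeffs_def)
  have f: "interlacing_seq f N"
    unfolding f_def N_def by (rule section_poly_interlacing)
  have f_nonneg: "nonneg_coeffs (f p)" for p
    unfolding f_def by (rule section_poly_nonneg)
  define P H where "P i = (\<Sum>p<M+i. f p)" and "H i = (\<Sum>p=M+i..<N. f p)" for i
  define B where "B i = section_poly s n (s * Suc n + i)" for i
  have B: "B i = pCons 0 (P i) + H i" if "i \<le> n" for i
    using section_poly_last_block[of i k s] that
    by (simp only: B_def n_def shifted_sum_def P_def H_def f_def N_def M_def)
  have PH: "P i + H i = (\<Sum>p<N. f p)" if "i \<le> n" for i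
    using that by (simp add: P_def H_def N lessThan_atLeast0 sum.atLeastLessThan_concat)
  define e where "e i = c i - c (n - i)" for i
  have rev: "(\<Sum>i\<le>n. g (n - i)) = (\<Sum>i\<le>n. g i)" for g :: "nat \<Rightarrow> real"
    by (rule sum.reindex_bij_witness[of _ "\<lambda>i. n - i" "\<lambda>i. n - i"]) auto
  have e_sum: "(\<Sum>i\<le>n. e i) = 0"
    using rev[of c] by (simp add: e_def sum_subtractf)
  \<comment> \<open>As \<open>e\<close> has total \<open>0\<close>, this tail is the slack in the
    hypothesis at \<open>j\<close>.\<close>
  define \<beta> where "\<beta> j = (\<Sum>i=Suc j..n. e i)" for j
  have \<beta>_le: "\<beta> j = (\<Sum>i\<le>j. c (n - i)) - (\<Sum>i\<le>j. c i)" if "j \<le> k" for j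
  proof -
    have "(\<Sum>i\<le>n. e i) = (\<Sum>i\<le>j. e i) + \<beta> j"
      unfolding \<beta>_def using that
      by (subst sum.union_disjoint[symmetric])
         (auto simp: n_def simp del: sum.atMost_Suc intro!: sum.cong)
    then show ?thesis
      using e_sum by (simp add: e_def sum_subtractf)
  qed
  have \<beta>_sym: "\<beta> (k - j) = \<beta> j" if "j \<le> k" for j
  proof -
    have "\<beta> j = (\<Sum>i\<le>k-j. c (n - i) - c i)"
      unfolding \<beta>_def e_def
      by (rule sum.reindex_bij_witness[of _ "\<lambda>i. n - i" "\<lambda>i. n - i"]) (use that in \<open>auto simp: n_def\<close>)
    then show ?thesis
      using \<beta>_le[of "k - j"] by (simp add: sum_subtractf)
  qed
  \<comment> \<open>The hypothesis reaches only up to \<open>n div 2\<close>, but one of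
    \<open>j\<close> and \<open>k - j\<close> lies in that range.\<close>
  have \<beta>_nonneg: "\<beta> j \<ge> 0" if "j \<le> k" for j
  proof -
    have "j \<le> n div 2 \<or> k - j \<le> n div 2"
      unfolding n_def by linarith
    then show ?thesis
      using le[of j] le[of "k - j"] \<beta>_le[of j] \<beta>_le[of "k - j"] \<beta>_sym that by auto
  qed
  define u w where "u = (\<Sum>i\<le>n. smult (c i) (H i))" and "w = (\<Sum>i\<le>n. smult (c (n - i)) (P i))"
  define a b where "a = u + pCons 0 w" and "b = (\<Sum>i\<le>n. smult (e i) (P i))"
  \<comment> \<open>Summation by parts; the common part \<open>P 0\<close> drops out because
    \<open>e\<close> has total \<open>0\<close>.\<close>
  have b: "b = (\<Sum>j\<le>k. smult (\<beta> j) (f (M + j)))"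
  proof -
    have smult_sum_right: "smult d (sum g A) = (\<Sum>i\<in>A. smult d (g i))"
      for d and g :: "nat \<Rightarrow> real poly" and A
      by (induction A rule: infinite_finite_induct) (simp_all add: smult_add_right)
    have "P i = P 0 + (\<Sum>j<i. f (M + j))" for i
      by (induction i) (simp_all add: P_def add.assoc)
    then have "b = (\<Sum>i\<le>n. smult (e i) (P 0) + (\<Sum>j<i. smult (e i) (f (M + j))))"
      unfolding b_def by (metis (no_types) smult_add_right smult_sum_right)
    also have "\<dots> = smult (\<Sum>i\<le>n. e i) (P 0) + (\<Sum>j<n. \<Sum>i=Suc j..n. smult (e i) (f (M + j)))"
      by (simp add: sum.distrib smult_sum sum.nested_swap')
    finally show ?thesis
      unfolding e_sum \<beta>_def smult_sum by (simp add: n_def lessThan_Suc_atMost)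
  qed
  have D: "D_op n (Suc s) h = (\<Sum>i\<le>n. smult (c i) (B i))"
    unfolding D_op_eq B_def c_def ..
  have D_eq: "D_op n (Suc s) h = a + [:0, 1:] * b"
  proof (rule poly_ext)
    fix x
    show "poly (D_op n (Suc s) h) x = poly (a + [:0, 1:] * b) x"
      by (simp add: D B a_def b_def u_def w_def e_def poly_sum sum_distrib_left algebra_simps
          flip: sum.distrib)
  qed
  have b_rec: "x ^ k * poly b (1 / x) = poly b x" if "x \<noteq> 0" for x
  proof -
    have "x ^ k * poly b (1 / x) = (\<Sum>j\<le>k. \<beta> j * (x ^ k * poly (f (M + j)) (1 / x)))"
      by (simp add: b poly_sum sum_distrib_left mult_ac)
    also have "\<dots> = (\<Sum>j\<le>k. \<beta> (k - j) * poly (f (M + (k - j))) x)"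
      using section_poly_reciprocal(2)[OF that] \<beta>_sym
      by (intro sum.cong) (auto simp: f_def M_def simp del: mult_Suc_right)
    also have "\<dots> = (\<Sum>j\<le>k. \<beta> j * poly (f (M + j)) x)"
      by (rule sum.reindex_bij_witness[of _ "\<lambda>i. k - i" "\<lambda>i. k - i"]) auto
    finally show ?thesis
      by (simp add: b poly_sum)
  qed
  \<comment> \<open>Reversing \<open>D_op\<close> replaces \<open>c i\<close> by
    \<open>c (n - i)\<close>. The defect is a combination of the sums \<open>P i + H i\<close> with
    weights \<open>e i\<close>; these sums do not depend on \<open>i\<close>, so it
    vanishes.\<close>
  have a_rec: "x ^ n * poly a (1 / x) = poly a x" if x: "x \<noteq> 0" for x
  proof -
    have "x ^ n * poly (D_op n (Suc s) h) (1 / x) = (\<Sum>i\<le>n. c i * (x ^ n * poly (B i) (1 / x)))"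
      by (simp add: D poly_sum sum_distrib_left mult_ac)
    also have "\<dots> = (\<Sum>i\<le>n. c (n - (n - i)) * poly (B (n - i)) x)"
      using section_poly_reciprocal(2)[OF x]
      by (intro sum.cong) (auto simp: B_def simp del: mult_Suc_right)
    also have "\<dots> = (\<Sum>i\<le>n. c (n - i) * poly (B i) x)"
      by (rule rev)
    finally have 1: "x ^ n * poly (D_op n (Suc s) h) (1 / x) = (\<Sum>i\<le>n. c (n - i) * poly (B i) x)" .
    have "x ^ n * poly (D_op n (Suc s) h) (1 / x) = x ^ n * poly a (1 / x) + x ^ k * poly b (1 / x)"
      unfolding D_eq using x by (simp add: n_def algebra_simps)
    then have "x ^ n * poly a (1 / x) = (\<Sum>i\<le>n. c (n - i) * poly (B i) x) - poly b x"
      using 1 b_rec[OF x] by simp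
    also have "\<dots> - poly a x = - (\<Sum>i\<le>n. e i * poly (P i + H i) x)"
      by (simp add: B a_def b_def u_def w_def e_def poly_sum sum_distrib_left algebra_simps
          flip: sum.distrib sum_subtractf sum_negf)
    also have "\<dots> = - (\<Sum>i\<le>n. e i * poly (\<Sum>p<N. f p) x)"
      using PH by simp
    also have "\<dots> = 0"
      by (simp add: e_sum flip: sum_distrib_right)
    finally show ?thesis by simp
  qed
  have "symmetric_decomposition n (D_op n (Suc s) h) a b"
    unfolding symmetric_decomposition_def self_reciprocal_def
    using D_eq a_rec b_rec by (simp add: power_int_of_nat) (simp add: n_def)
  moreover have "nonneg_coeffs a"
    unfolding a_def u_def w_def P_def H_def using c f_nonneg
    by (intro nonneg_coeffs_add nonneg_coeffs_shift nonneg_coeffs_sum nonneg_coeffs_smult) auto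
  moreover have "nonneg_coeffs b"
    unfolding b using \<beta>_nonneg f_nonneg by (intro nonneg_coeffs_sum nonneg_coeffs_smult) auto
  moreover have "real_rooted b"
    unfolding b f_def M_def
    by (intro upper_stable_imp_real_rooted section_poly_combination_upper_stable \<beta>_nonneg)
  moreover have "real_rooted a"
  proof -
    have "interlacing_seq H (Suc n)" "interlacing_seq P (Suc n)"
      using interlacing_seq_sum[OF f] interlacing_seq_suffixes[OF f] interlacing_seq_prefixes[OF f]
      by (auto simp: interlacing_seq_def H_def P_def N lessThan_atLeast0)
    then have "interlacing_seq (\<lambda>i. smult (c i) (H i)) (Suc n)"
      "interlacing_seq (\<lambda>i. smult (c (n - i)) (P i)) (Suc n)"
      using c by (simp_all add: interlacing_seq_smult)
    then have "upper_stable u" "upper_stable w"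
      unfolding u_def w_def lessThan_Suc_atMost[symmetric] lessThan_atLeast0
      by (blast intro: interlacing_seq_sum)+
    \<comment> \<open>Every prefix sum interlaces every suffix sum, whatever the two cuts, so the
      reversed weights in \<open>w\<close> do no harm.\<close>
    moreover have "w \<lless> u"
      unfolding u_def w_def P_def H_def using c
      by (intro interlaces_sum_left interlaces_sum_right interlaces_smult
          interlacing_seq_prefix_suffix[OF f]) (auto simp: N)
    ultimately show ?thesis
      unfolding a_def
      by (intro upper_stable_imp_real_rooted upper_stable_add interlaces_shift_right upper_stable_shift)
  qed
  ultimately show ?thesis by blast
qed

theorem theorem1p3:
  fixes h :: "real poly" and n r :: nat
  assumes "degree h \<le> n"
    and "nonneg_coeffs h"
    and "r > 0"
  shows "real_rooted (D_op n r h) \<and>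
    ((\<forall>i\<le>n div 2. (\<Sum>j\<le>i. coeff h j) \<le> (\<Sum>j\<le>i. coeff h (n - j))) \<longrightarrow>
      (\<exists>a b. symmetric_decomposition n (D_op n r h) a b \<and>
             nonneg_coeffs a \<and> nonneg_coeffs b \<and>
             real_rooted a \<and> real_rooted b))"
proof -
  obtain s where r: "r = Suc s"
    using assms(3) gr0_implies_Suc by blast
  have rr: "real_rooted (D_op n r h)"
    unfolding r D_op_eq using assms(2)
    by (intro upper_stable_imp_real_rooted section_poly_combination_upper_stable)
       (simp add: nonneg_coeffs_def)
  show ?thesis
  proof (intro conjI impI rr)
    assume le: "\<forall>i\<le>n div 2. (\<Sum>j\<le>i. coeff h j) \<le> (\<Sum>j\<le>i. coeff h (n - j))"
    show "\<exists>a b. symmetric_decomposition n (D_op n r h) a b \<and>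
        nonneg_coeffs a \<and> nonneg_coeffs b \<and> real_rooted a \<and> real_rooted b"
    proof (cases n)
      \<comment> \<open>No preceding family exists here; the constant \<open>D_op\<close> itself is
        \<open>a\<close>, and \<open>b = 0\<close>.\<close>
      case 0
      have "D_op 0 r h = [:coeff h 0:]"
        by (simp add: r D_op_eq)
      then have "symmetric_decomposition n (D_op n r h) (D_op n r h) 0"
        "nonneg_coeffs (D_op n r h)"
        using assms(2) 0
        by (auto simp: symmetric_decomposition_def self_reciprocal_def nonneg_coeffs_def coeff_pCons
            split: nat.split)
      then show ?thesis
        using rr by (intro exI[of _ "D_op n r h"] exI[of _ 0])
          (auto simp: nonneg_coeffs_def real_rooted_def)
    next
      case (Suc k)
      then show ?thesis
        using symmetric_decomposition_D_op[of h k s] assms(2) le by (auto simp: r)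
    qed
  qed
qed

end
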